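(* Let $n\ge1$ be an integer and $m\in(0,1)$. Let $\boldsymbol\rho_0^{(1)},\boldsymbol\rho_0^{(2)}\in\mathbb{R}^{2n-1}$ and $\eta_0^{(1)},\eta_0^{(2)}\in\mathbb{R}$ be such that $Z_n(\boldsymbol\rho_0^{(i)},\eta_0^{(i)})<\infty$ for $i=1,2$. If $\pi$ is the probability distribution on $[0,1]$ with density $$\pi_m^{(n)}(b)=\frac{\phi_n\bigl(\frac{\bar b}{\bar m};\boldsymbol\rho_0^{(1)},\eta_0^{(1)}\bigr)\mathbf{1}_{(m,1)}(b)+\phi_n\bigl(\frac bm;\boldsymbol\rho_0^{(2)},\eta_0^{(2)}\bigr)\mathbf{1}_{(0,m]}(b)}{\bar mZ_n(\boldsymbol\rho_0^{(1)},\eta_0^{(1)})+mZ_n(\boldsymbol\rho_0^{(2)},\eta_0^{(2)})},$$ then for any $t\ge1$ and $y^t\in[0,1]^t$, $$\frac{W_t^\pi(y^t;\frac1m,\frac1{\bar m})}{W_0}\ \ge\ \frac{\bar mZ_n\bigl(\boldsymbol\rho_n(y^t;m)+\boldsymbol\rho_0^{(1)},\eta_n(y^t;m)+\eta_0^{(1)}\bigr)+mZ_n\bigl(\boldsymbol\rho_n(\bar y^t;\bar m)+\boldsymbol\rho_0^{(2)},\eta_n(\bar y^t;\bar m)+\eta_0^{(2)}\bigr)}{\bar mZ_n(\boldsymbol\rho_0^{(1)},\eta_0^{(1)})+mZ_n(\boldsymbol\rho_0^{(2)},\eta_0^{(2)})}.$$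
   Context: For a number $x$, $\bar x=1-x$, and $\bar y^t=(1-y_i)_{i=1}^t$. For $\boldsymbol\rho\in\mathbb{R}^{2n-1}$, $\eta\in\mathbb{R}$ and $x\in(0,1]$, $\phi_n(x;\boldsymbol\rho,\eta)=\exp\bigl(\sum_{k=1}^{2n-1}\frac{(1-x)^k}{k}\rho_k+\eta\log x\bigr)$ and $Z_n(\boldsymbol\rho,\eta)=\int_0^1\phi_n(x;\boldsymbol\rho,\eta)\,dx$. For $y^t\in[0,1]^t$ and $m\in(0,1)$, $\boldsymbol\rho_n(y^t;m)\in\mathbb{R}^{2n-1}$ has components $(\boldsymbol\rho_n(y^t;m))_k=\sum_{i=1}^t\{(1-\frac{y_i}m)^{2n}-(1-\frac{y_i}m)^k\}$, $k=1,\dots,2n-1$, and $\eta_n(y^t;m)=\sum_{i=1}^t(1-\frac{y_i}m)^{2n}$. The wealth of the constant bettor $b\in[0,1]$ is $W_t^b(y^t;\frac1m,\frac1{\bar m})=W_0\prod_{i=1}^t\bigl(\frac{y_i}mb+\frac{\bar y_i}{\bar m}\bar b\bigr)$, $W_0>0$, and $W_t^\pi=\int W_t^b\,d\pi(b)$. *)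

theory Defs
  imports "HOL-Probability.Probability"
begin

text \<open>
  Vectors in \<open>\<real>\<^sup>2\<^sup>n\<^sup>-\<^sup>1\<close> and sequences \<open>y\<^sup>t\<close> are functions on \<^typ>\<open>nat\<close>, indexed from 1; only the
  components \<open>1, \<dots>, 2n - 1\<close>, respectively \<open>1, \<dots>, t\<close>, are ever used.
\<close>

definition phi :: "nat \<Rightarrow> real \<Rightarrow> (nat \<Rightarrow> real) \<Rightarrow> real \<Rightarrow> real" where
  "phi n x \<rho> \<eta> = exp ((\<Sum>k=1..2*n-1. (1 - x) ^ k / real k * \<rho> k) + \<eta> * ln x)"

text \<open>
  The integral of the positive function \<^const>\<open>phi\<close> is taken in \<open>[0, \<infinity>]\<close>, so that its finiteness is
  a genuine condition.
\<close>

definition Zn :: "nat \<Rightarrow> (nat \<Rightarrow> real) \<Rightarrow> real \<Rightarrow> ennreal" where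
  "Zn n \<rho> \<eta> = (\<integral>\<^sup>+x\<in>{0<..1}. ennreal (phi n x \<rho> \<eta>) \<partial>lborel)"

definition rho_n :: "nat \<Rightarrow> nat \<Rightarrow> (nat \<Rightarrow> real) \<Rightarrow> real \<Rightarrow> nat \<Rightarrow> real" where
  "rho_n n t y m k = (\<Sum>i=1..t. (1 - y i / m) ^ (2*n) - (1 - y i / m) ^ k)"

definition eta_n :: "nat \<Rightarrow> nat \<Rightarrow> (nat \<Rightarrow> real) \<Rightarrow> real \<Rightarrow> real" where
  "eta_n n t y m = (\<Sum>i=1..t. (1 - y i / m) ^ (2*n))"

text \<open>Wealth with odds \<open>1 / m\<close> and \<open>1 / (1 - m)\<close>.\<close>

definition wealth :: "real \<Rightarrow> nat \<Rightarrow> (nat \<Rightarrow> real) \<Rightarrow> real \<Rightarrow> real \<Rightarrow> real" where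
  "wealth W0 t y m b = W0 * (\<Prod>i=1..t. y i / m * b + (1 - y i) / (1 - m) * (1 - b))"

definition mixture_wealth :: "real \<Rightarrow> nat \<Rightarrow> (nat \<Rightarrow> real) \<Rightarrow> real \<Rightarrow> real measure \<Rightarrow> real" where
  "mixture_wealth W0 t y m \<pi> = (\<integral>b. wealth W0 t y m b \<partial>\<pi>)"

definition prior_density ::
  "nat \<Rightarrow> real \<Rightarrow> (nat \<Rightarrow> real) \<Rightarrow> real \<Rightarrow> (nat \<Rightarrow> real) \<Rightarrow> real \<Rightarrow> real \<Rightarrow> ennreal" where
  "prior_density n m \<rho>1 \<eta>1 \<rho>2 \<eta>2 b =
     (ennreal (phi n ((1 - b) / (1 - m)) \<rho>1 \<eta>1) * indicator {m<..<1} b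
        + ennreal (phi n (b / m) \<rho>2 \<eta>2) * indicator {0<..m} b)
     / (ennreal (1 - m) * Zn n \<rho>1 \<eta>1 + ennreal m * Zn n \<rho>2 \<eta>2)"

definition prior ::
  "nat \<Rightarrow> real \<Rightarrow> (nat \<Rightarrow> real) \<Rightarrow> real \<Rightarrow> (nat \<Rightarrow> real) \<Rightarrow> real \<Rightarrow> real measure" where
  "prior n m \<rho>1 \<eta>1 \<rho>2 \<eta>2 =
     density (restrict_space lborel {0..1}) (prior_density n m \<rho>1 \<eta>1 \<rho>2 \<eta>2)"

lemma phi_measurable [measurable]: "(\<lambda>x. phi n x \<rho> \<eta>) \<in> borel_measurable borel"
  unfolding phi_def by measurable

lemma phi_pos: "phi n x \<rho> \<eta> > 0"
  by (simp add: phi_def)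

lemma Zn_pos: "Zn n \<rho> \<eta> > 0"
proof -
  have "Zn n \<rho> \<eta> \<noteq> 0"
  proof
    assume "Zn n \<rho> \<eta> = 0"
    then have "AE x in lborel. ennreal (phi n x \<rho> \<eta>) * indicator {0<..1} x = 0"
      unfolding Zn_def by (subst (asm) nn_integral_0_iff_AE) auto
    then have "AE x in lborel. x \<notin> {0<..1::real}"
    proof eventually_elim
      case (elim x)
      then show ?case using phi_pos[of n x \<rho> \<eta>] by (auto simp: indicator_def split: if_splits)
    qed
    moreover have "{x \<in> space lborel. \<not> x \<notin> {0<..1::real}} = {0<..1}" by auto
    ultimately have "emeasure lborel {0<..1::real} = 0"
      using AE_iff_measurable[of "{0<..1::real}" lborel "\<lambda>x. x \<notin> {0<..1}"]
      by (metis greaterThanAtMost_borel sets_lborel)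
    then show False by simp
  qed
  then show ?thesis by (simp add: zero_less_iff_neq_zero)
qed

lemma prior_part1:
  assumes "0 < m" "m < 1"
  shows "(\<integral>\<^sup>+b. ennreal (phi n ((1 - b) / (1 - m)) \<rho> \<eta>) * indicator {m<..<1} b \<partial>lborel)
    = ennreal (1 - m) * Zn n \<rho> \<eta>"
proof -
  have "(\<integral>\<^sup>+b. ennreal (phi n ((1 - b) / (1 - m)) \<rho> \<eta>) * indicator {m<..<1} b \<partial>lborel)
    = ennreal \<bar>- (1 - m)\<bar> * (\<integral>\<^sup>+x. ennreal (phi n ((1 - (1 + (- (1 - m)) * x)) / (1 - m)) \<rho> \<eta>)
        * indicator {m<..<1} (1 + (- (1 - m)) * x) \<partial>lborel)"
    by (rule nn_integral_real_affine) (use assms in auto)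
  also have "(\<integral>\<^sup>+x. ennreal (phi n ((1 - (1 + (- (1 - m)) * x)) / (1 - m)) \<rho> \<eta>)
        * indicator {m<..<1} (1 + (- (1 - m)) * x) \<partial>lborel) = Zn n \<rho> \<eta>"
    unfolding Zn_def
  proof (rule nn_integral_cong_AE)
    have "AE x in lborel. x \<noteq> (1::real)" by (rule AE_lborel_singleton)
    then show "AE x in lborel. ennreal (phi n ((1 - (1 + (- (1 - m)) * x)) / (1 - m)) \<rho> \<eta>)
        * indicator {m<..<1} (1 + (- (1 - m)) * x)
        = ennreal (phi n x \<rho> \<eta>) * indicator {0<..1} x"
    proof eventually_elim
      case (elim x)
      have a: "(1 - (1 + (- (1 - m)) * x)) / (1 - m) = x" using assms by (simp add: field_simps)
      have b: "1 + (- (1 - m)) * x < 1 \<longleftrightarrow> 0 < x"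
        using assms by (simp add: mult_less_0_iff)
      have c: "m < 1 + (- (1 - m)) * x \<longleftrightarrow> x < 1"
      proof -
        have "m < 1 + (- (1 - m)) * x \<longleftrightarrow> 0 < (1 - m) * (1 - x)" by (auto simp: algebra_simps)
        then show ?thesis using assms by (simp add: zero_less_mult_iff)
      qed
      have "(1 + (- (1 - m)) * x \<in> {m<..<1}) = (x \<in> {0<..1})" using b c elim by auto
      then show ?case unfolding a by (simp add: indicator_def)
    qed
  qed
  finally show ?thesis using assms by simp
qed

lemma prior_part2:
  assumes "0 < m"
  shows "(\<integral>\<^sup>+b. ennreal (phi n (b / m) \<rho> \<eta>) * indicator {0<..m} b \<partial>lborel)
    = ennreal m * Zn n \<rho> \<eta>"
proof -
  have "(\<integral>\<^sup>+b. ennreal (phi n (b / m) \<rho> \<eta>) * indicator {0<..m} b \<partial>lborel)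
    = ennreal \<bar>m\<bar> * (\<integral>\<^sup>+x. ennreal (phi n ((0 + m * x) / m) \<rho> \<eta>)
        * indicator {0<..m} (0 + m * x) \<partial>lborel)"
    by (rule nn_integral_real_affine) (use assms in auto)
  also have "(\<integral>\<^sup>+x. ennreal (phi n ((0 + m * x) / m) \<rho> \<eta>)
        * indicator {0<..m} (0 + m * x) \<partial>lborel) = Zn n \<rho> \<eta>"
    unfolding Zn_def
    by (rule nn_integral_cong) (use assms in \<open>auto simp: indicator_def zero_less_mult_iff\<close>)
  finally show ?thesis using assms by simp
qed

lemma prior_density_measurable [measurable]:
  "prior_density n m \<rho>1 \<eta>1 \<rho>2 \<eta>2 \<in> borel_measurable borel"
  unfolding prior_density_def by measurable

lemma prob_space_prior:
  assumes "0 < m" "m < 1" "Zn n \<rho>1 \<eta>1 < \<infinity>" "Zn n \<rho>2 \<eta>2 < \<infinity>"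
  shows "prob_space (prior n m \<rho>1 \<eta>1 \<rho>2 \<eta>2)"
proof (rule prob_spaceI)
  define D where "D = ennreal (1 - m) * Zn n \<rho>1 \<eta>1 + ennreal m * Zn n \<rho>2 \<eta>2"
  define N where "N = (\<lambda>b. ennreal (phi n ((1 - b) / (1 - m)) \<rho>1 \<eta>1) * indicator {m<..<1} b
        + ennreal (phi n (b / m) \<rho>2 \<eta>2) * indicator {0<..m} b)"
  have D0: "D \<noteq> 0" using assms Zn_pos[of n \<rho>2 \<eta>2] by (auto simp: D_def)
  have Dfin: "D \<noteq> \<infinity>" using assms by (auto simp: D_def ennreal_mult_eq_top_iff)
  have N [measurable]: "N \<in> borel_measurable borel" unfolding N_def by measurable
  have f: "prior_density n m \<rho>1 \<eta>1 \<rho>2 \<eta>2 = (\<lambda>b. N b / D)"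
    by (simp add: fun_eq_iff prior_density_def N_def D_def)
  have "emeasure (prior n m \<rho>1 \<eta>1 \<rho>2 \<eta>2) (space (prior n m \<rho>1 \<eta>1 \<rho>2 \<eta>2))
      = (\<integral>\<^sup>+b. prior_density n m \<rho>1 \<eta>1 \<rho>2 \<eta>2 b \<partial>restrict_space lborel {0..1})"
  proof -
    have "prior_density n m \<rho>1 \<eta>1 \<rho>2 \<eta>2 \<in> borel_measurable (restrict_space lborel {0..1})"
      by (rule measurable_restrict_space1) simp
    moreover have "space (prior n m \<rho>1 \<eta>1 \<rho>2 \<eta>2) = space (restrict_space lborel {0..1})"
      by (simp add: prior_def)
    ultimately show ?thesis
      unfolding prior_def
      by (simp only: space_density emeasure_density sets.top)
         (intro nn_integral_cong, simp)
  qed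
  also have "\<dots> = (\<integral>\<^sup>+b. prior_density n m \<rho>1 \<eta>1 \<rho>2 \<eta>2 b * indicator {0..1} b \<partial>lborel)"
    by (subst nn_integral_restrict_space) auto
  also have "\<dots> = (\<integral>\<^sup>+b. N b / D \<partial>lborel)"
    unfolding f by (rule nn_integral_cong) (use assms in \<open>auto simp: N_def indicator_def\<close>)
  also have "\<dots> = (\<integral>\<^sup>+b. N b \<partial>lborel) / D"
    by (rule nn_integral_divide) auto
  also have "(\<integral>\<^sup>+b. N b \<partial>lborel) = D"
    unfolding N_def D_def using assms
    by (subst nn_integral_add) (auto simp: prior_part1 prior_part2)
  also have "D / D = 1" using D0 Dfin by (simp add: ennreal_divide_self less_top)
  finally show "emeasure (prior n m \<rho>1 \<eta>1 \<rho>2 \<eta>2) (space (prior n m \<rho>1 \<eta>1 \<rho>2 \<eta>2)) = 1" .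
qed

end

theory Submission
  imports Defs
begin

text \<open>
  For \<open>b > m\<close> put \<open>x = (1 - b) / (1 - m)\<close>. With \<open>u = 1 - y / m \<le> 1\<close> a one-round wealth factor becomes
  \<open>1 - u (1 - x)\<close>. The remainder of the logarithmic series divided by \<open>z\<^sup>2\<^sup>n\<close>,
  \<open>(- ln (1 - z) - (\<Sum>1\<le>k<2n. z\<^sup>k / k)) / z\<^sup>2\<^sup>n\<close>, increases in \<open>z < 1\<close>; comparing its values at \<open>u (1 - x)\<close>
  and \<open>1 - x\<close> bounds the factor from below by a value of \<^const>\<open>phi\<close>. These functions multiply by
  adding their parameters, so the bounds combine with the prior into its conjugate update.
  The case \<open>b \<le> m\<close> is the same after exchanging the two outcomes.
\<close>

lemma phi_add: "phi n x (\<lambda>k. \<rho> k + \<rho>' k) (\<eta> + \<eta>') = phi n x \<rho> \<eta> * phi n x \<rho>' \<eta>'"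
  by (simp add: phi_def distrib_left distrib_right sum.distrib flip: exp_add)

lemma phi_sum:
  "finite I \<Longrightarrow> phi n x (\<lambda>k. \<Sum>i\<in>I. \<rho> i k) (\<Sum>i\<in>I. \<eta> i) = (\<Prod>i\<in>I. phi n x (\<rho> i) (\<eta> i))"
  by (induction I rule: finite_induct) (simp_all add: phi_add, simp add: phi_def)

text \<open>This is the monotonicity of the divided remainder with denominators cleared, so that
  \<open>u = 0\<close> and \<open>z = 0\<close> cause no division by zero. The even exponent allows
  \<open>u\<close> of either sign.\<close>

lemma ln_series_remainder_le:
  fixes u z :: real
  assumes "u \<le> 1" "0 \<le> z" "z < 1"
  shows "u ^ (2 * n) * (ln (1 - z) + (\<Sum>k=1..2*n-1. z ^ k / real k))
    \<le> ln (1 - u * z) + (\<Sum>k=1..2*n-1. (u * z) ^ k / real k)"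
proof (cases "n = 0")
  case True
  \<comment> \<open>Truncated subtraction makes \<open>2*n-1\<close> zero here: both sums are empty
    and only monotonicity of \<open>ln\<close> remains.\<close>
  have "u * z \<le> z" using assms mult_right_mono[of u 1 z] by simp
  then show ?thesis using True assms by simp
next
  case False
  define r where "r = (\<lambda>s::real. ln (1 - s) + (\<Sum>k=1..2*n-1. s ^ k / real k))"
  \<comment> \<open>Differentiating the polynomial gives a partial geometric sum, which cancels
    \<open>- 1 / (1 - s)\<close> up to its tail.\<close>
  have r: "(r has_real_derivative - (s ^ (2*n-1) / (1 - s))) (at s)" if "s < 1" for s
  proof -
    have "(\<Sum>k=1..2*n-1. real k * s ^ (k - 1) / real k) = (\<Sum>k<2*n-1. s ^ k)"
      by (rule sum.reindex_bij_witness[of _ Suc "\<lambda>k. k - 1"]) auto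
    also have "\<dots> = (1 - s ^ (2*n-1)) / (1 - s)"
      using that by (simp add: sum_gp_strict)
    finally have "- 1 / (1 - s) + (\<Sum>k=1..2*n-1. real k * s ^ (k - 1) / real k)
        = - (s ^ (2*n-1) / (1 - s))"
      by (simp add: diff_divide_distrib)
    moreover have "(r has_real_derivative
        - 1 / (1 - s) + (\<Sum>k=1..2*n-1. real k * s ^ (k - 1) / real k)) (at s)"
      unfolding r_def using that by (auto intro!: derivative_eq_intros)
    ultimately show ?thesis by simp
  qed
  \<comment> \<open>\<open>F\<close> is the difference of the two sides as a function of
    \<open>z\<close>. It vanishes at 0, so a nonnegative derivative on \<open>[0, z]\<close>
    suffices.\<close>
  define F where "F = (\<lambda>z. r (u * z) - u ^ (2*n) * r z)"
  have "F 0 \<le> F z"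
  proof (rule DERIV_nonneg_imp_nondecreasing[OF assms(2)])
    fix v assume "0 \<le> v" "v \<le> z"
    with assms have v: "v < 1" "u * v \<le> v"
      using mult_right_mono[of u 1 v] by simp_all
    have "(F has_real_derivative
        - ((u * v) ^ (2*n-1) / (1 - u * v)) * u - u ^ (2*n) * - (v ^ (2*n-1) / (1 - v))) (at v)"
      unfolding F_def using v
      by (intro DERIV_diff DERIV_cmult DERIV_chain2[of r] r) (auto intro!: derivative_eq_intros)
    \<comment> \<open>The chain-rule factor \<open>u\<close> completes \<open>u ^ (2*n-1)\<close> to
      \<open>u ^ (2*n)\<close>, which relies on \<open>n\<close> being nonzero.\<close>
    also have "- ((u * v) ^ (2*n-1) / (1 - u * v)) * u - u ^ (2*n) * - (v ^ (2*n-1) / (1 - v))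
        = u ^ (2*n) * (v ^ (2*n-1) / (1 - v) - v ^ (2*n-1) / (1 - u * v))"
      using False power_Suc2[of u "2*n-1"] by (simp add: power_mult_distrib algebra_simps)
    finally have "(F has_real_derivative
        u ^ (2*n) * (v ^ (2*n-1) / (1 - v) - v ^ (2*n-1) / (1 - u * v))) (at v)" .
    \<comment> \<open>The power of \<open>u\<close> is even, and \<open>u * v \<le> v < 1\<close>
      orders the two denominators.\<close>
    moreover have "0 \<le> u ^ (2*n) * (v ^ (2*n-1) / (1 - v) - v ^ (2*n-1) / (1 - u * v))"
      using v \<open>0 \<le> v\<close> by (intro mult_nonneg_nonneg) (auto intro!: divide_left_mono)
    ultimately show "\<exists>d. (F has_real_derivative d) (at v) \<and> 0 \<le> d" by blast
  qed
  moreover have "r 0 = 0" unfolding r_def by (auto intro!: sum.neutral)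
  then have "F 0 = 0" by (simp add: F_def)
  ultimately have "0 \<le> F z" by simp
  then show ?thesis by (simp add: F_def r_def)
qed

text \<open>Exponentiated form of the remainder inequality at \<open>z = 1 - x\<close>. With
  \<open>u = 1 - y i / m\<close> the parameters are the \<open>i\<close>-th summands of
  \<open>rho_n\<close> and \<open>eta_n\<close>.\<close>

lemma phi_le_linear:
  assumes "u \<le> 1" "0 < x" "x \<le> 1"
  shows "phi n x (\<lambda>k. u ^ (2 * n) - u ^ k) (u ^ (2 * n)) \<le> 1 - u * (1 - x)"
proof -
  have "u * (1 - x) \<le> 1 - x" using assms mult_right_mono[of u 1 "1 - x"] by simp
  then have pos: "0 < 1 - u * (1 - x)" using assms by simp
  have split: "(\<Sum>k=1..2*n-1. z ^ k / real k * (u ^ (2*n) - u ^ k))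
      = u ^ (2*n) * (\<Sum>k=1..2*n-1. z ^ k / real k) - (\<Sum>k=1..2*n-1. (u * z) ^ k / real k)" for z
    unfolding sum_distrib_left sum_subtractf[symmetric]
    by (rule sum.cong) (simp_all add: power_mult_distrib field_simps)
  have "(\<Sum>k=1..2*n-1. (1 - x) ^ k / real k * (u ^ (2*n) - u ^ k)) + u ^ (2*n) * ln x
      = u ^ (2*n) * (ln (1 - (1 - x)) + (\<Sum>k=1..2*n-1. (1 - x) ^ k / real k))
        - (\<Sum>k=1..2*n-1. (u * (1 - x)) ^ k / real k)"
    unfolding split distrib_left by simp
  also have "\<dots> \<le> ln (1 - u * (1 - x))"
    using ln_series_remainder_le[of u "1 - x" n] assms by simp
  finally show ?thesis
    unfolding phi_def ln_ge_iff[OF pos] .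
qed

text \<open>The one-round bounds are multiplied over the rounds; \<open>0 \<le> y i\<close> gives
  \<open>u \<le> 1\<close> in each. The endpoint \<open>b = m\<close> is included so that the
  mirrored instance covers all of \<open>0 < b \<le> m\<close>.\<close>

lemma phi_posterior_le:
  assumes "0 < m" "m < 1" "\<And>i. i \<in> {1..t} \<Longrightarrow> 0 \<le> y i" "m \<le> b" "b < 1"
  shows "phi n ((1 - b) / (1 - m)) (\<lambda>k. rho_n n t y m k + \<rho> k) (eta_n n t y m + \<eta>)
    \<le> (\<Prod>i=1..t. y i / m * b + (1 - y i) / (1 - m) * (1 - b)) * phi n ((1 - b) / (1 - m)) \<rho> \<eta>"
proof -
  define x where "x = (1 - b) / (1 - m)"
  have x: "0 < x" "x \<le> 1" using assms by (simp_all add: x_def)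
  have b: "b = 1 - (1 - m) * x" using assms by (simp add: x_def)
  have "phi n x (rho_n n t y m) (eta_n n t y m)
      = (\<Prod>i=1..t. phi n x (\<lambda>k. (1 - y i / m) ^ (2*n) - (1 - y i / m) ^ k) ((1 - y i / m) ^ (2*n)))"
    unfolding rho_n_def eta_n_def by (rule phi_sum) simp
  also have "\<dots> \<le> (\<Prod>i=1..t. y i / m * b + (1 - y i) / (1 - m) * (1 - b))"
  proof (rule prod_mono, intro conjI)
    fix i assume i: "i \<in> {1..t}"
    have "1 - (1 - y i / m) * (1 - x) = y i / m * b + (1 - y i) / (1 - m) * (1 - b)"
      unfolding b using assms by (simp add: field_simps)
    then show "phi n x (\<lambda>k. (1 - y i / m) ^ (2*n) - (1 - y i / m) ^ k) ((1 - y i / m) ^ (2*n))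
        \<le> y i / m * b + (1 - y i) / (1 - m) * (1 - b)"
      using phi_le_linear[of "1 - y i / m" x n] x assms(1) assms(3)[OF i] by simp
  qed (simp add: less_imp_le phi_pos)
  finally show ?thesis
    unfolding x_def[symmetric] phi_add by (rule mult_right_mono) (simp add: less_imp_le phi_pos)
qed

text \<open>Passes from the real-valued integral to one in \<open>[0, \<infinity>]\<close> against
  Lebesgue measure, where integrands can be compared pointwise.\<close>

lemma ennreal_mixture_wealth:
  assumes "0 < m" "m < 1" "0 < W0" "Zn n \<rho>1 \<eta>1 < \<infinity>" "Zn n \<rho>2 \<eta>2 < \<infinity>"
    and y: "\<And>i. i \<in> {1..t} \<Longrightarrow> y i \<in> {0..1}"
  shows "ennreal (mixture_wealth W0 t y m (prior n m \<rho>1 \<eta>1 \<rho>2 \<eta>2) / W0)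
    = (\<integral>\<^sup>+b. ennreal (\<Prod>i=1..t. y i / m * b + (1 - y i) / (1 - m) * (1 - b))
        * prior_density n m \<rho>1 \<eta>1 \<rho>2 \<eta>2 b * indicator {0..1} b \<partial>lborel)"
proof -
  define P where "P = (\<lambda>b. \<Prod>i=1..t. y i / m * b + (1 - y i) / (1 - m) * (1 - b))"
  define M where "M = prior n m \<rho>1 \<eta>1 \<rho>2 \<eta>2"
  interpret prob_space M
    unfolding M_def using assms by (intro prob_space_prior)
  have space: "space M = {0..1}" by (simp add: M_def prior_def space_restrict_space)
  have P_meas [measurable]: "P \<in> borel_measurable borel" unfolding P_def by measurable
  have P_M: "P \<in> borel_measurable M"
    unfolding M_def prior_def by (simp add: measurable_restrict_space1)
  have P_nonneg: "0 \<le> P b" if "b \<in> {0..1}" for b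
    unfolding P_def using assms(1,2) y that by (intro prod_nonneg) auto
  \<comment> \<open>A continuous function on \<open>[0, 1]\<close> is bounded, hence integrable
    under a probability measure; for a non-integrable function the real integral would default to
    0.\<close>
  have "compact (P ` {0..1})"
    unfolding P_def by (intro compact_continuous_image continuous_intros) (use assms in auto)
  then obtain C where C: "\<And>b. b \<in> {0..1} \<Longrightarrow> norm (P b) \<le> C"
    using compact_imp_bounded by (fastforce simp: bounded_iff)
  have C_AE: "AE b in M. norm (P b) \<le> C" and P_AE: "AE b in M. 0 \<le> P b"
    by (rule AE_I2, simp only: space C P_nonneg)+
  have "integrable M P" using C_AE P_M by (rule integrable_const_bound)
  have "mixture_wealth W0 t y m M / W0 = (\<integral>b. P b \<partial>M)"
    using assms by (simp add: mixture_wealth_def wealth_def P_def)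
  then have "ennreal (mixture_wealth W0 t y m M / W0) = (\<integral>\<^sup>+b. ennreal (P b) \<partial>M)"
    by (simp only: nn_integral_eq_integral[OF \<open>integrable M P\<close> P_AE])
  also have "\<dots> = (\<integral>\<^sup>+b. prior_density n m \<rho>1 \<eta>1 \<rho>2 \<eta>2 b * ennreal (P b)
      \<partial>restrict_space lborel {0..1})"
    unfolding M_def prior_def
    by (rule nn_integral_density) (auto intro!: measurable_restrict_space1)
  also have "\<dots> = (\<integral>\<^sup>+b. prior_density n m \<rho>1 \<eta>1 \<rho>2 \<eta>2 b * ennreal (P b) * indicator {0..1} b
      \<partial>lborel)"
    by (rule nn_integral_restrict_space) auto
  finally show ?thesis by (simp add: M_def P_def mult.commute)
qed

theorem theorem18:
  fixes n t :: nat and m \<eta>1 \<eta>2 W0 :: real and \<rho>1 \<rho>2 y :: "nat \<Rightarrow> real"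
  assumes "n \<ge> 1"
    and "0 < m" and "m < 1"
    and "W0 > 0"
    and "Zn n \<rho>1 \<eta>1 < \<infinity>" and "Zn n \<rho>2 \<eta>2 < \<infinity>"
    and "t \<ge> 1"
    and "\<And>i. i \<in> {1..t} \<Longrightarrow> y i \<in> {0..1}"
  shows "ennreal (mixture_wealth W0 t y m (prior n m \<rho>1 \<eta>1 \<rho>2 \<eta>2) / W0)
    \<ge> (ennreal (1 - m) * Zn n (\<lambda>k. rho_n n t y m k + \<rho>1 k) (eta_n n t y m + \<eta>1)
        + ennreal m * Zn n (\<lambda>k. rho_n n t (\<lambda>i. 1 - y i) (1 - m) k + \<rho>2 k)
                           (eta_n n t (\<lambda>i. 1 - y i) (1 - m) + \<eta>2))
      / (ennreal (1 - m) * Zn n \<rho>1 \<eta>1 + ennreal m * Zn n \<rho>2 \<eta>2)"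
proof -
  define P where "P = (\<lambda>b. \<Prod>i=1..t. y i / m * b + (1 - y i) / (1 - m) * (1 - b))"
  define D where "D = ennreal (1 - m) * Zn n \<rho>1 \<eta>1 + ennreal m * Zn n \<rho>2 \<eta>2"
  define \<rho>1' where "\<rho>1' = (\<lambda>k. rho_n n t y m k + \<rho>1 k)"
  define \<eta>1' where "\<eta>1' = eta_n n t y m + \<eta>1"
  define \<rho>2' where "\<rho>2' = (\<lambda>k. rho_n n t (\<lambda>i. 1 - y i) (1 - m) k + \<rho>2 k)"
  define \<eta>2' where "\<eta>2' = eta_n n t (\<lambda>i. 1 - y i) (1 - m) + \<eta>2"
  \<comment> \<open>The numerator of the prior density with its parameters left free: the same form
    serves the prior and its conjugate update.\<close>
  define N where "N = (\<lambda>\<rho> \<eta> \<rho>' \<eta>' b.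
    ennreal (phi n ((1 - b) / (1 - m)) \<rho> \<eta>) * indicator {m<..<1} b
      + ennreal (phi n (b / m) \<rho>' \<eta>') * indicator {0<..m} b)"
  have N_meas [measurable]: "N \<rho> \<eta> \<rho>' \<eta>' \<in> borel_measurable borel" for \<rho> \<eta> \<rho>' \<eta>'
    unfolding N_def by measurable
  have upper: "ennreal (phi n ((1 - b) / (1 - m)) \<rho>1' \<eta>1')
      \<le> ennreal (P b) * ennreal (phi n ((1 - b) / (1 - m)) \<rho>1 \<eta>1)" if "m < b" "b < 1" for b
  proof -
    have "phi n ((1 - b) / (1 - m)) \<rho>1' \<eta>1' \<le> P b * phi n ((1 - b) / (1 - m)) \<rho>1 \<eta>1"
      unfolding P_def \<rho>1'_def \<eta>1'_def using assms that by (intro phi_posterior_le) auto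
    then show ?thesis by (simp add: ennreal_leI less_imp_le phi_pos flip: ennreal_mult'')
  qed
  have lower: "ennreal (phi n (b / m) \<rho>2' \<eta>2') \<le> ennreal (P b) * ennreal (phi n (b / m) \<rho>2 \<eta>2)"
    if "0 < b" "b \<le> m" for b
  proof -
    \<comment> \<open>Replacing \<open>m\<close>, \<open>y i\<close>, \<open>b\<close> by their
      complements to 1 leaves \<open>P b\<close> unchanged and turns
      \<open>(1 - b) / (1 - m)\<close> into \<open>b / m\<close>.\<close>
    have "phi n (b / m) \<rho>2' \<eta>2' \<le> P b * phi n (b / m) \<rho>2 \<eta>2"
      using phi_posterior_le[of "1 - m" t "\<lambda>i. 1 - y i" "1 - b" n \<rho>2 \<eta>2] assms that
      by (simp add: P_def \<rho>2'_def \<eta>2'_def add.commute)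
    then show ?thesis by (simp add: ennreal_leI less_imp_le phi_pos flip: ennreal_mult'')
  qed
  \<comment> \<open>The substitutions that normalise the prior apply to the updated parameters too,
    as identities in \<open>[0, \<infinity>]\<close>.\<close>
  have "(ennreal (1 - m) * Zn n \<rho>1' \<eta>1' + ennreal m * Zn n \<rho>2' \<eta>2') / D
      = (\<integral>\<^sup>+b. N \<rho>1' \<eta>1' \<rho>2' \<eta>2' b \<partial>lborel) / D"
    unfolding N_def using assms by (subst nn_integral_add) (auto simp: prior_part1 prior_part2)
  also have "\<dots> = (\<integral>\<^sup>+b. N \<rho>1' \<eta>1' \<rho>2' \<eta>2' b / D \<partial>lborel)"
    by (rule nn_integral_divide[symmetric]) simp
  also have "\<dots> \<le> (\<integral>\<^sup>+b. ennreal (P b) * prior_density n m \<rho>1 \<eta>1 \<rho>2 \<eta>2 b * indicator {0..1} b \<partial>lborel)"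
  proof (rule nn_integral_mono)
    fix b :: real
    \<comment> \<open>At most one branch of \<open>N\<close> is active at each \<open>b\<close>;
      outside the open unit interval the left side is 0.\<close>
    have "N \<rho>1' \<eta>1' \<rho>2' \<eta>2' b \<le> ennreal (P b) * N \<rho>1 \<eta>1 \<rho>2 \<eta>2 b * indicator {0..1} b"
      using upper[of b] lower[of b] assms(2,3) by (auto simp: N_def indicator_def)
    then have "N \<rho>1' \<eta>1' \<rho>2' \<eta>2' b / D \<le> ennreal (P b) * N \<rho>1 \<eta>1 \<rho>2 \<eta>2 b * indicator {0..1} b / D"
      by (rule divide_right_mono_ennreal)
    also have "\<dots> = ennreal (P b) * prior_density n m \<rho>1 \<eta>1 \<rho>2 \<eta>2 b * indicator {0..1} b"
      by (simp add: prior_density_def N_def D_def divide_ennreal_def mult_ac)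
    finally show "N \<rho>1' \<eta>1' \<rho>2' \<eta>2' b / D
      \<le> ennreal (P b) * prior_density n m \<rho>1 \<eta>1 \<rho>2 \<eta>2 b * indicator {0..1} b" .
  qed
  also have "\<dots> = ennreal (mixture_wealth W0 t y m (prior n m \<rho>1 \<eta>1 \<rho>2 \<eta>2) / W0)"
    unfolding P_def using assms by (intro ennreal_mixture_wealth[symmetric]) auto
  finally show ?thesis unfolding D_def \<rho>1'_def \<eta>1'_def \<rho>2'_def \<eta>2'_def .
qed

end
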